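(* Let $\theta=(\theta_1,\ldots,\theta_5)\in\mathbb{R}^5$ be such that $BH_\theta$ exists and $\theta_1+\theta_5>0$, $\theta_1+\theta_4>0$, $\theta_2+\theta_3>0$. Let $X\sim BH_{\theta_1,\{\theta_2,\theta_3\},\{\theta_4,\theta_5\}}$, $W\sim\beta^{(2)}_{\theta_1+\theta_5,\theta_2+\theta_3}$ and $W'\sim\beta^{(2)}_{\theta_1+\theta_4,\theta_2+\theta_3}$ be such that $(W,W')$ is independent of $X$. Then $$\frac{1}{1+WX}\sim BH_{\theta_5,\{\theta_1,\theta_4\},\{\theta_2,\theta_3\}},\qquad \frac{1}{1+W'X}\sim BH_{\theta_4,\{\theta_1,\theta_5\},\{\theta_2,\theta_3\}}$$ (in particular these two distributions exist).
   Context: $\mathbb{N}=\{0,1,2,\ldots\}$. $_2F_1(p,q;r;x)=\sum_{n\ge0}\frac{(p)_n(q)_n}{n!(r)_n}x^n$ with $(t)_0=1$, $(t)_{n+1}=(t+n)(t)_n$, for real $p,q,r$ with $r\notin-\mathbb{N}$ and $0<x<1$. $P$ is the set of $(a,b,p,q,r)\in\mathbb{R}^5$ such that $r\notin-\mathbb{N}$, $_2F_1(p,q;r;x)>0$ for all $x\in(0,1)$, $a>0$, $b>0$ and $r+b-p-q>0$. For $(a,b,p,q,r)\in P$, $BH(a,b,p,q,r)$ is the probability on $(0,1)$ with density proportional to $x^{a-1}(1-x)^{b-1}\,_2F_1(p,q;r;x)$. For $\theta\in\mathbb{R}^5$ set $a=\theta_4+\theta_5$, $b=\theta_1+\theta_3$,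 $p=\theta_3+\theta_5$, $q=\theta_3+\theta_4$, $r=\theta_2+\theta_3+\theta_4+\theta_5$. If $(a,b,p,q,r)\in P$ we say that $BH_\theta$ exists and put $BH_\theta=BH(a,b,p,q,r)$. Existence and value of $BH_\theta$ are unchanged by exchanging $\theta_2$ with $\theta_3$, or $\theta_4$ with $\theta_5$, whence the notation $BH_\theta=BH_{\theta_1,\{\theta_2,\theta_3\},\{\theta_4,\theta_5\}}$ (unordered pairs, repetition allowed). For $c,d>0$, $\beta^{(2)}_{c,d}$ is the probability on $(0,\infty)$ with density $\frac{1}{B(c,d)}\frac{w^{c-1}}{(1+w)^{c+d}}$. *)

theory Defs
  imports "HOL-Probability.Probability"
begin

definition hyp2F1 :: "real \<Rightarrow> real \<Rightarrow> real \<Rightarrow> real \<Rightarrow> real" where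
  "hyp2F1 p q r x =
     (\<Sum>n. pochhammer p n * pochhammer q n / (fact n * pochhammer r n) * x ^ n)"

definition BH_params :: "(real \<times> real \<times> real \<times> real \<times> real) set" where
  "BH_params = {(a, b, p, q, r).
     r \<notin> \<int>\<^sub>\<le>\<^sub>0 \<and> (\<forall>x\<in>{0<..<1}. hyp2F1 p q r x > 0) \<and>
     a > 0 \<and> b > 0 \<and> r + b - p - q > 0}"

definition BH_weight :: "real \<Rightarrow> real \<Rightarrow> real \<Rightarrow> real \<Rightarrow> real \<Rightarrow> real \<Rightarrow> ennreal" where
  "BH_weight a b p q r x =
     ennreal (indicator {0<..<1} x *
       (x powr (a - 1) * (1 - x) powr (b - 1) * hyp2F1 p q r x))"

text \<open>The measure below is a probability on the Borel sets of the real line, carried by the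
  open unit interval, for parameters in \<open>BH_params\<close>; otherwise its value is meaningless.\<close>

definition BH :: "real \<Rightarrow> real \<Rightarrow> real \<Rightarrow> real \<Rightarrow> real \<Rightarrow> real measure" where
  "BH a b p q r =
     density lborel (\<lambda>x. BH_weight a b p q r x / (\<integral>\<^sup>+ y. BH_weight a b p q r y \<partial>lborel))"

text \<open>In the parametrization by \<open>(t1, \<dots>, t5)\<close>, exchanging \<open>t2\<close> with \<open>t3\<close> (Euler's transformation
  of \<open>hyp2F1\<close>) or \<open>t4\<close> with \<open>t5\<close> changes neither existence nor the measure. The law written with
  unordered pairs \<open>t1, {t2, t3}, {t4, t5}\<close> is therefore rendered by the ordered tuple.\<close>

definition BH_theta_exists :: "real \<Rightarrow> real \<Rightarrow> real \<Rightarrow> real \<Rightarrow> real \<Rightarrow> bool" where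
  "BH_theta_exists t1 t2 t3 t4 t5 \<longleftrightarrow>
     (t4 + t5, t1 + t3, t3 + t5, t3 + t4, t2 + t3 + t4 + t5) \<in> BH_params"

definition BH_theta :: "real \<Rightarrow> real \<Rightarrow> real \<Rightarrow> real \<Rightarrow> real \<Rightarrow> real measure" where
  "BH_theta t1 t2 t3 t4 t5 =
     BH (t4 + t5) (t1 + t3) (t3 + t5) (t3 + t4) (t2 + t3 + t4 + t5)"

definition beta2 :: "real \<Rightarrow> real \<Rightarrow> real measure" where
  "beta2 c d =
     density lborel (\<lambda>w. ennreal (indicator {0<..} w *
       (1 / Beta c d * (w powr (c - 1) / (1 + w) powr (c + d)))))"

end

(* Write c = t1 + t5 and d = t2 + t3. Substituting y = 1 / (1 + w x) in the law of W and using
   a + d = r, the density of 1 / (1 + W X) at y is proportional to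
     y^(d-1) (1-y)^(c-1) * integral of x^(r-1) (1-x)^(b-1) F(p,q;r;x) (1 - y (1-x))^-(c+d) over (0,1).
   Expanding the last factor in powers of y (1-x) produces the integrals
     J_n = integral of x^(r-1) (1-x)^(b+n-1) F(p,q;r;x) = B(r,b+n) F(p,q;r+b+n;1),
   whose successive ratios are rational in n because F(p,q;g;1) and F(p,q;g+1;1) are proportional.
   So the inner integral is J_0 F(b,r+b-p-q;r+b-p;y), and Euler's transformation turns this into
   the required weight. No constant has to be evaluated, since both sides have mass one. The second
   law follows by exchanging t4 and t5. *)
theory Submission
  imports Defs "HOL-Real_Asymp.Real_Asymp"
begin

section \<open>Hypergeometric coefficients: recurrence, convergence, growth and values at 1\<close>

definition hyp_coeff :: "real \<Rightarrow> real \<Rightarrow> real \<Rightarrow> nat \<Rightarrow> real" where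
  "hyp_coeff p q r n = pochhammer p n * pochhammer q n / (fact n * pochhammer r n)"

lemma hyp2F1_eq: "hyp2F1 p q r x = (\<Sum>n. hyp_coeff p q r n * x ^ n)"
  by (simp add: hyp2F1_def hyp_coeff_def)

lemma hyp2F1_commute: "hyp2F1 p q r = hyp2F1 q p r"
  by (simp add: hyp2F1_def mult.commute fun_eq_iff)

lemma hyp_coeff_0 [simp]: "hyp_coeff p q r 0 = 1"
  by (simp add: hyp_coeff_def)

text \<open>Valid for every \<open>r\<close>: where \<open>r + n\<close> vanishes, both sides are 0,
  since division by zero gives 0.\<close>

lemma hyp_coeff_Suc:
  "hyp_coeff p q r (Suc n) = hyp_coeff p q r n * ((p + n) * (q + n) / ((1 + n) * (r + n)))"
  by (simp add: hyp_coeff_def pochhammer_Suc mult_ac)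

text \<open>The recurrence without denominators, in the shape in which \<open>hyp_ode_nth\<close>
  produces it.\<close>

lemma hyp_coeff_Suc_mult:
  assumes "r \<notin> \<int>\<^sub>\<le>\<^sub>0"
  shows "(real n + 1) * (real n + r) * hyp_coeff p q r (Suc n) = (n + p) * (n + q) * hyp_coeff p q r n"
proof -
  have "r + real n \<noteq> 0"
    using assms plus_of_nat_eq_0_imp by blast
  moreover have "1 + real n \<noteq> 0" by linarith
  ultimately show ?thesis
    unfolding hyp_coeff_Suc by (simp add: divide_simps) (simp add: algebra_simps)
qed

text \<open>Ratio test: the factor between successive coefficients tends to 1, so the terms
  eventually shrink by a factor \<open>c\<close> between \<open>\<bar>x\<bar>\<close> and 1.\<close>

lemma summable_hyp2F1:
  assumes "\<bar>x\<bar> < 1"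
  shows "summable (\<lambda>n. \<bar>hyp_coeff p q r n * x ^ n\<bar>)"
proof -
  define \<rho> where "\<rho> n = (p + real n) * (q + real n) / ((1 + real n) * (r + real n))" for n :: nat
  have "\<rho> \<longlonglongrightarrow> 1"
    unfolding \<rho>_def by real_asymp
  then have "(\<lambda>n. \<bar>\<rho> n * x\<bar>) \<longlonglongrightarrow> \<bar>1 * x\<bar>"
    by (intro tendsto_intros)
  moreover obtain c where c: "\<bar>x\<bar> < c" "c < 1"
    using assms dense by blast
  ultimately have "\<forall>\<^sub>F n in sequentially. \<bar>\<rho> n * x\<bar> < c"
    by (auto dest: order_tendstoD(2))
  then obtain N where N: "\<And>n. n \<ge> N \<Longrightarrow> \<bar>\<rho> n * x\<bar> < c"
    by (auto simp: eventually_sequentially)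
  have "\<bar>hyp_coeff p q r (Suc n) * x ^ Suc n\<bar> \<le> c * \<bar>hyp_coeff p q r n * x ^ n\<bar>" if "n \<ge> N" for n
  proof -
    have "\<bar>hyp_coeff p q r (Suc n) * x ^ Suc n\<bar> = \<bar>\<rho> n * x\<bar> * \<bar>hyp_coeff p q r n * x ^ n\<bar>"
      by (simp add: hyp_coeff_Suc \<rho>_def abs_mult)
    also have "\<dots> \<le> c * \<bar>hyp_coeff p q r n * x ^ n\<bar>"
      using N[OF that] by (intro mult_right_mono) auto
    finally show ?thesis .
  qed
  then show ?thesis
    using c by (intro summable_ratio_test[of c N]) auto
qed

text \<open>Each Pochhammer symbol is compared with the series for the reciprocal Gamma function,
  whose limit at \<open>r\<close> is nonzero. The index is \<open>Suc n\<close> because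
  \<open>rGamma_series z n\<close> contains \<open>pochhammer z (Suc n)\<close>.\<close>

lemma hyp_coeff_asymp:
  assumes "r \<notin> \<int>\<^sub>\<le>\<^sub>0"
  shows "(\<lambda>n. hyp_coeff p q r (Suc n)) \<in> O(\<lambda>n. real n powr (p + q - r - 1))"
proof -
  have "(\<lambda>n. rGamma_series p n * rGamma_series q n / rGamma_series r n)
      \<longlonglongrightarrow> rGamma p * rGamma q / rGamma r"
    using assms by (intro tendsto_intros) (simp add: rGamma_eq_zero_iff)
  then have "(\<lambda>n. rGamma_series p n * rGamma_series q n / rGamma_series r n) \<in> O(\<lambda>_. 1)"
    by (intro bigoI_tendsto[where c = "rGamma p * rGamma q / rGamma r"]) auto
  then have "(\<lambda>n. rGamma_series p n * rGamma_series q n / rGamma_series r n *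
          (real n powr (p + q - r) / (1 + real n)))
      \<in> O(\<lambda>n. 1 * real n powr (p + q - r - 1))"
    by (rule landau_o.big.mult) real_asymp
  moreover have "\<forall>\<^sub>F n in sequentially. hyp_coeff p q r (Suc n) =
      rGamma_series p n * rGamma_series q n / rGamma_series r n *
          (real n powr (p + q - r) / (1 + real n))"
    \<comment> \<open>At \<open>n = 0\<close> the factor \<open>exp (z * ln n)\<close> of
      \<open>rGamma_series\<close> is not \<open>n powr z\<close>.\<close>
    using eventually_gt_at_top[of "0::nat"]
  proof eventually_elim
    case (elim n)
    then have "exp (z * ln (real n)) = real n powr z" for z
      by (simp add: powr_def)
    with elim show ?case
      by (simp add: hyp_coeff_def rGamma_series_def powr_add powr_diff divide_simps)
  qed
  ultimately show ?thesis
    by (subst landau_o.big.in_cong) auto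
qed

text \<open>Convergence at the boundary point 1: the exponent in \<open>hyp_coeff_asymp\<close> is
  now below -1.\<close>

lemma summable_abs_hyp_coeff:
  assumes "r \<notin> \<int>\<^sub>\<le>\<^sub>0" "p + q < r"
  shows "summable (\<lambda>n. \<bar>hyp_coeff p q r n\<bar>)"
proof (subst summable_Suc_iff [symmetric], rule summable_comparison_test_bigo)
  show "summable (\<lambda>n. norm (real n powr (p + q - r - 1)))"
    using assms by (simp add: summable_real_powr_iff)
  show "(\<lambda>n. \<bar>hyp_coeff p q r (Suc n)\<bar>) \<in> O(\<lambda>n. real n powr (p + q - r - 1))"
    using hyp_coeff_asymp[OF assms(1)] by simp
qed

text \<open>Kills the boundary term of the telescoping sum in
  \<open>hyp2F1_at_1_contiguous\<close>.\<close>

lemma hyp_coeff_mult_index_tendsto_0: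
  assumes "r \<notin> \<int>\<^sub>\<le>\<^sub>0" "p + q < r"
  shows "(\<lambda>n. real n * hyp_coeff p q r n) \<longlonglongrightarrow> 0"
proof -
  have "(\<lambda>n. real (Suc n) * hyp_coeff p q r (Suc n)) \<in> O(\<lambda>n. real n * real n powr (p + q - r - 1))"
    using hyp_coeff_asymp[OF assms(1)] by (intro landau_o.big.mult) real_asymp+
  moreover have "(\<lambda>n. real n * real n powr (p + q - r - 1)) \<in> o(\<lambda>_. 1)"
  proof (rule smalloI_tendsto)
    define e where "e = r - p - q"
    have "e > 0" using assms by (simp add: e_def)
    then have "(\<lambda>n. real n * real n powr (- e - 1)) \<longlonglongrightarrow> 0" by real_asymp
    then show "(\<lambda>n. real n * real n powr (p + q - r - 1) / 1) \<longlonglongrightarrow> 0"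
      by (simp add: e_def algebra_simps)
  qed auto
  ultimately have "(\<lambda>n. real (Suc n) * hyp_coeff p q r (Suc n)) \<in> o(\<lambda>_. 1)"
    by (rule landau_o.big_small_trans)
  then have "(\<lambda>n. real (Suc n) * hyp_coeff p q r (Suc n)) \<longlonglongrightarrow> 0"
    by (auto dest: smalloD_tendsto)
  then show ?thesis
    by (rule LIMSEQ_imp_Suc)
qed

text \<open>A consequence of Gauss's formula for the value at 1, but the telescoping below avoids that
  formula: the difference of the two series is the series of increments of \<open>- r * k * t k\<close>.\<close>

lemma hyp2F1_at_1_contiguous:
  assumes r: "r > 0" and less: "p + q < r"
  shows "(r - p) * (r - q) * hyp2F1 p q (r + 1) 1 = r * (r - p - q) * hyp2F1 p q r 1"
proof -
  have r': "r \<notin> \<int>\<^sub>\<le>\<^sub>0" "r + 1 \<notin> \<int>\<^sub>\<le>\<^sub>0"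
    using r by (auto dest: nonpos_Ints_nonpos)
  define t where "t = hyp_coeff p q r"
  have t': "hyp_coeff p q (r + 1) k = t k * r / (r + k)" for k
  proof -
    have "pochhammer (r + 1) k * r = pochhammer r k * (r + k)"
      using pochhammer_rec[of r k] pochhammer_Suc[of r k] by (simp add: mult_ac)
    moreover have "pochhammer (r + 1) k > 0" "pochhammer r k > 0"
      using r by (simp_all add: pochhammer_pos)
    ultimately show ?thesis
      using r unfolding t_def hyp_coeff_def by (simp add: divide_simps) (simp add: algebra_simps)
  qed
  \<comment> \<open>Both ends of the telescoping sum are 0: the limit by the previous lemma, the
    start by its factor \<open>0\<close>.\<close>
  have "(\<lambda>k. (- r * (Suc k * t (Suc k))) - (- r * (k * t k))) sums (0 - (- r * (real 0 * t 0)))"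
    unfolding t_def using tendsto_mult_left[OF hyp_coeff_mult_index_tendsto_0[OF r'(1) less], of "- r"]
    by (intro telescope_sums) (simp del: of_nat_Suc)
  moreover have "(- r * (Suc k * t (Suc k))) - (- r * (k * t k)) =
      r * (r - p - q) * t k - (r - p) * (r - q) * hyp_coeff p q (r + 1) k" for k
  proof -
    have "r + real k > 0" using r by simp
    moreover have "1 + real k \<noteq> 0" by linarith
    ultimately show ?thesis
      unfolding t' by (simp add: t_def hyp_coeff_Suc divide_simps) (simp add: algebra_simps)
  qed
  ultimately have "(\<lambda>k. r * (r - p - q) * t k - (r - p) * (r - q) * hyp_coeff p q (r + 1) k) sums 0"
    by simp
  moreover have "(\<lambda>k. r * (r - p - q) * t k - (r - p) * (r - q) * hyp_coeff p q (r + 1) k) sums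
      (r * (r - p - q) * hyp2F1 p q r 1 - (r - p) * (r - q) * hyp2F1 p q (r + 1) 1)"
    using summable_rabs_cancel[OF summable_abs_hyp_coeff[OF r'(1), of p q]]
      summable_rabs_cancel[OF summable_abs_hyp_coeff[OF r'(2), of p q]] less
    by (intro sums_diff sums_mult) (simp_all add: hyp2F1_eq t_def summable_sums)
  ultimately show ?thesis
    by (auto dest: sums_unique2)
qed

section \<open>Binomial series and Euler's transformation\<close>

text \<open>The signs of the generalized binomial coefficient and of \<open>(- x) ^ n\<close>
  cancel. The series serves both for Euler's factor and for expanding the kernel
  \<open>(1 - y * (1 - x)) powr (- s)\<close>.\<close>

lemma binomial_series_pochhammer:
  fixes x :: real
  assumes "\<bar>x\<bar> < 1"
  shows "(\<lambda>n. pochhammer s n / fact n * x ^ n) sums (1 - x) powr (- s)"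
proof -
  have "(\<lambda>n. (- s gchoose n) * (- x) ^ n) sums (1 + - x) powr (- s)"
    using assms by (intro gen_binomial_real) auto
  moreover have "(- s gchoose n) * (- x) ^ n = pochhammer s n / fact n * x ^ n" for n
  proof -
    have "(- 1) ^ n * (- x) ^ n = x ^ n"
      by (simp flip: power_mult_distrib)
    then show ?thesis
      by (simp add: gbinomial_pochhammer)
  qed
  ultimately show ?thesis by simp
qed

text \<open>For Euler's transformation: formal solutions of the hypergeometric equation are determined by
  their constant coefficient, and multiplication by \<open>(1 - x) powr e\<close> maps solutions for
  \<open>r - p, r - q\<close> to solutions for \<open>p, q\<close>.\<close>

definition hyp_ode :: "real \<Rightarrow> real \<Rightarrow> real \<Rightarrow> real fps \<Rightarrow> real fps" where
  "hyp_ode p q r f =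
     fps_X * (1 - fps_X) * fps_deriv (fps_deriv f)
     + (fps_const r - fps_const (p + q + 1) * fps_X) * fps_deriv f - fps_const (p * q) * f"

text \<open>Comparing coefficients turns the differential equation into a two-term
  recurrence.\<close>

lemma hyp_ode_nth:
  "fps_nth (hyp_ode p q r f) n =
     (real n + 1) * (real n + r) * fps_nth f (Suc n) - (n + p) * (n + q) * fps_nth f n"
proof (cases n)
  case 0
  then show ?thesis by (simp add: hyp_ode_def algebra_simps)
next
  case (Suc m)
  then show ?thesis
    \<comment> \<open>The term with the square of \<open>fps_X\<close> reaches two indices back, so
      \<open>n = 1\<close> is a case of its own.\<close>
    by (cases m) (simp_all add: hyp_ode_def algebra_simps)
qed

text \<open>The leading factor of the recurrence never vanishes, so every coefficient determines the
  next one.\<close>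

lemma hyp_ode_solution:
  assumes "r \<notin> \<int>\<^sub>\<le>\<^sub>0" "hyp_ode p q r f = 0"
  shows "fps_nth f n = fps_nth f 0 * hyp_coeff p q r n"
proof (induction n)
  case (Suc n)
  have nz: "(real n + 1) * (real n + r) \<noteq> 0"
  proof -
    have "r + real n \<noteq> 0"
      using assms(1) plus_of_nat_eq_0_imp by blast
    moreover have "real n + 1 \<noteq> 0" by linarith
    ultimately show ?thesis by (simp add: add.commute)
  qed
  have "(real n + 1) * (real n + r) * fps_nth f (Suc n) = (n + p) * (n + q) * fps_nth f n"
    using hyp_ode_nth[of p q r f n] assms(2) by simp
  also have "\<dots> = (real n + 1) * (real n + r) * (fps_nth f 0 * hyp_coeff p q r (Suc n))"
    using hyp_coeff_Suc_mult[OF assms(1), of n p q] Suc by (simp add: mult_ac)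
  finally show ?case
    using nz by simp
qed simp

text \<open>The condition on \<open>u\<close> is the differential equation of the power
  \<open>e\<close> of \<open>1 - fps_X\<close>, stated formally.\<close>

lemma hyp_ode_Euler:
  fixes u G :: "real fps"
  assumes e: "e = r - p - q"
  assumes u: "(1 - fps_X) * fps_deriv u = - fps_const e * u"
  assumes G: "hyp_ode (r - p) (r - q) r G = 0"
  shows "hyp_ode p q r (u * G) = 0"
proof -
  \<comment> \<open>Opaque names for constants and derivatives reduce the claim to an identity of
    polynomials.\<close>
  define P Q R E where c: "P = fps_const p" "Q = fps_const q" "R = fps_const r" "E = fps_const e"
  define u' G' u'' G'' X where d: "u' = fps_deriv u" "G' = fps_deriv G"
    "u'' = fps_deriv u'" "G'' = fps_deriv G'" "X = (fps_X :: real fps)"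
  have E: "E = R - P - Q"
    unfolding c e by simp
  have 1: "(1 - X) * u' = - E * u"
    using u by (simp add: c d)
  have "fps_deriv ((1 - X) * u') = fps_deriv (- E * u)"
    using 1 by simp
  then have 2: "(1 - X) * u'' - u' = - E * u'"
    by (simp add: c d)
  have 3: "X * (1 - X) * G'' + (R - (R - P + (R - Q) + 1) * X) * G' - (R - P) * (R - Q) * G = 0"
  proof -
    have "fps_const (r - p + (r - q) + 1) = R - P + (R - Q) + 1"
      by (simp only: c fps_const_sub fps_const_add flip: fps_const_1_eq_1)
    moreover have "fps_const ((r - p) * (r - q)) = (R - P) * (R - Q)"
      by (simp only: c fps_const_sub fps_const_mult)
    ultimately show ?thesis
      using G unfolding hyp_ode_def by (simp only: c(3) d)
  qed
  \<comment> \<open>After multiplication by \<open>1 - X\<close> the expression is a combination of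
    the three vanishing quantities in 1, 2 and 3. The factor can then be cancelled, since power
    series form an integral domain.\<close>
  have "(1 - X) * (X * (1 - X) * (u'' * G + 2 * u' * G' + u * G'') + (R - (P + Q + 1) * X) * (u' * G + u * G')
      - P * Q * (u * G)) = 0"
  proof -
    have "(1 - X) * (X * (1 - X) * (u'' * G + 2 * u' * G' + u * G'') + (R - (P + Q + 1) * X) * (u' * G + u * G')
        - P * Q * (u * G)) =
      X * G * (1 - X) * ((1 - X) * u'' - u' + E * u') +
      (X * G * (1 - E) + 2 * X * (1 - X) * G' + (R - (P + Q + 1) * X) * G) * ((1 - X) * u' + E * u) +
      u * (1 - X) * (X * (1 - X) * G'' + (R - (R - P + (R - Q) + 1) * X) * G' - (R - P) * (R - Q) * G)"
      unfolding E by (simp add: algebra_simps)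
    also have "\<dots> = 0"
      using 1 2 3 by simp
    finally show ?thesis .
  qed
  moreover have "1 - X \<noteq> 0"
    unfolding d by (metis fps_X_neq_one right_minus_eq)
  ultimately have *: "X * (1 - X) * (u'' * G + 2 * u' * G' + u * G'') + (R - (P + Q + 1) * X) * (u' * G + u * G')
      - P * Q * (u * G) = 0"
    by simp
  then show ?thesis
  proof -
    have "fps_const (p + q + 1) = P + Q + 1" "fps_const (p * q) = P * Q"
      by (simp_all only: c fps_const_add fps_const_mult flip: fps_const_1_eq_1)
    moreover have "fps_deriv (u * G) = u' * G + u * G'"
      by (simp add: d)
    moreover from this have "fps_deriv (fps_deriv (u * G)) = u'' * G + 2 * u' * G' + u * G''"
      by (simp add: d algebra_simps)
    ultimately show ?thesis
      using * unfolding hyp_ode_def by (simp only: c(3) d(5))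
  qed
qed

text \<open>The formal product \<open>u * G\<close> solves the equation for \<open>p\<close>,
  \<open>q\<close> and has constant coefficient 1, so its coefficients are
  \<open>hyp_coeff p q r\<close>. Absolute convergence carries this over to values through the
  Cauchy product.\<close>

lemma hyp2F1_Euler:
  assumes r: "r \<notin> \<int>\<^sub>\<le>\<^sub>0" and x: "\<bar>x\<bar> < 1"
  shows "hyp2F1 p q r x = (1 - x) powr (r - p - q) * hyp2F1 (r - p) (r - q) r x"
proof -
  define e where "e = r - p - q"
  define u where "u = Abs_fps (\<lambda>n. pochhammer (- e) n / fact n :: real)"
  define G where "G = Abs_fps (hyp_coeff (r - p) (r - q) r)"
  have G: "hyp_ode (r - p) (r - q) r G = 0"
    by (rule fps_ext) (simp add: hyp_ode_nth G_def hyp_coeff_Suc_mult[OF r])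
  have "(1 - fps_X) * fps_deriv u = - fps_const e * u"
  proof (rule fps_ext)
    fix n
    show "fps_nth ((1 - fps_X) * fps_deriv u) n = fps_nth (- fps_const e * u) n"
    proof (cases n)
      case 0
      then show ?thesis by (simp add: u_def)
    next
      case (Suc m)
      have rec: "real (Suc k) * fps_nth u (Suc k) = (k - e) * fps_nth u k" for k
        by (simp add: u_def pochhammer_Suc del: of_nat_Suc)
      show ?thesis
        using rec[of n] rec[of m] unfolding Suc
        by (simp add: ring_distribs mult.assoc)
    qed
  qed
  then have "hyp_ode p q r (u * G) = 0"
    using G by (rule hyp_ode_Euler[OF e_def])
  then have nth: "fps_nth (u * G) n = hyp_coeff p q r n" for n
    using hyp_ode_solution[OF r, of p q "u * G" n] by (simp add: u_def G_def)
  then have coeff: "hyp_coeff p q r n * x ^ n =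
      (\<Sum>i\<le>n. (pochhammer (- e) i / fact i * x ^ i) * (hyp_coeff (r - p) (r - q) r (n - i) * x ^ (n - i)))" for n
  proof -
    have "hyp_coeff p q r n * x ^ n = fps_nth (u * G) n * x ^ n"
      by (simp add: nth)
    also have "\<dots> = (\<Sum>i\<le>n. fps_nth u i * fps_nth G (n - i) * x ^ n)"
      by (simp add: fps_mult_nth atLeast0AtMost sum_distrib_right)
    also have "\<dots> = (\<Sum>i\<le>n. (fps_nth u i * x ^ i) * (fps_nth G (n - i) * x ^ (n - i)))"
    proof (intro sum.cong)
      fix i assume "i \<in> {..n}"
      then have "x ^ n = x ^ i * x ^ (n - i)"
        by (simp flip: power_add)
      then show "fps_nth u i * fps_nth G (n - i) * x ^ n =
          (fps_nth u i * x ^ i) * (fps_nth G (n - i) * x ^ (n - i))"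
        by (simp only: mult_ac)
    qed simp
    finally show ?thesis
      by (simp add: u_def G_def)
  qed
  have "summable (\<lambda>n. norm (pochhammer (- e) n / fact n * x ^ n))"
  proof -
    \<comment> \<open>The binomial series is the hypergeometric one with \<open>q = r = 1\<close>,
      which settles its absolute convergence.\<close>
    have "hyp_coeff (- e) 1 1 n = pochhammer (- e) n / fact n" for n
      by (simp add: hyp_coeff_def flip: pochhammer_fact)
    then show ?thesis
      using summable_hyp2F1[OF x, of "- e" 1 1] by simp
  qed
  moreover have "summable (\<lambda>n. norm (hyp_coeff (r - p) (r - q) r n * x ^ n))"
    using summable_hyp2F1[OF x] by simp
  ultimately have "(\<lambda>n. hyp_coeff p q r n * x ^ n)
    sums ((\<Sum>n. pochhammer (- e) n / fact n * x ^ n) * (\<Sum>n. hyp_coeff (r - p) (r - q) r n * x ^ n))"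
    unfolding coeff by (rule Cauchy_product_sums)
  moreover have "(\<Sum>n. pochhammer (- e) n / fact n * x ^ n) = (1 - x) powr (r - p - q)"
    using sums_unique[OF binomial_series_pochhammer[OF x, of "- e"]] by (simp add: e_def)
  ultimately show ?thesis
    unfolding hyp2F1_eq by (simp only: sums_iff)
qed

section \<open>Beta integrals of \<open>hyp2F1\<close>\<close>

lemma borel_measurable_hyp2F1 [measurable]: "hyp2F1 p q r \<in> borel_measurable borel"
  unfolding hyp2F1_def[abs_def] by measurable

lemma has_bochner_integral_Beta:
  fixes a b :: real
  assumes "a > 0" "b > 0"
  shows "has_bochner_integral lborel
    (\<lambda>x. indicator {0<..<1} x * (x powr (a - 1) * (1 - x) powr (b - 1))) (Beta a b)"
proof -
  define f where "f = (\<lambda>x::real. indicator {0<..<1} x * (x powr (a - 1) * (1 - x) powr (b - 1)))"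
  have [measurable]: "f \<in> borel_measurable borel"
    unfolding f_def by measurable
  have "((\<lambda>x. x powr (a - 1) * (1 - x) powr (b - 1)) has_integral Beta a b) {0<..<1}"
    using has_integral_Beta_real[OF assms] by (simp add: has_integral_Icc_iff_Ioo)
  then have "((\<lambda>x. if x \<in> {0<..<1} then x powr (a - 1) * (1 - x) powr (b - 1) else 0) has_integral Beta a b) UNIV"
    by (subst has_integral_restrict_UNIV)
  then have "(f has_integral Beta a b) UNIV"
    by (rule has_integral_eq[rotated]) (auto simp: f_def)
  then have "integral\<^sup>N lborel f = ennreal (Beta a b)"
    by (intro nn_integral_has_integral_lborel) (auto simp: f_def)
  moreover have "Beta a b \<ge> 0"
    using assms by (simp add: Beta_def Gamma_real_pos less_imp_le)
  ultimately show ?thesis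
    unfolding f_def[symmetric]
    by (intro has_bochner_integral_nn_integral) (auto simp: f_def)
qed

lemma Beta_add_nat:
  fixes a b :: real
  assumes "a > 0" "b > 0"
  shows "Beta (a + n) b = Beta a b * pochhammer a n / pochhammer (a + b) n"
proof -
  have "Gamma (a + n) = pochhammer a n * Gamma a" "Gamma (a + b + n) = pochhammer (a + b) n * Gamma (a + b)"
  proof -
    have "Gamma (z + n) = pochhammer z n * Gamma z" if "z > 0" for z :: real
    proof -
      have "z \<notin> \<int>\<^sub>\<le>\<^sub>0"
        using that nonpos_Ints_nonpos[of z] by auto
      then show ?thesis
        using pochhammer_Gamma[of z n] Gamma_real_pos[OF that] by simp
    qed
    from this[of a] this[of "a + b"] show "Gamma (a + n) = pochhammer a n * Gamma a"
      "Gamma (a + b + n) = pochhammer (a + b) n * Gamma (a + b)"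
      using assms by auto
  qed
  then show ?thesis
    by (simp add: Beta_def ac_simps)
qed

text \<open>Termwise integration: the exponent \<open>r - 1\<close> matches the lower parameter, so
  \<open>Beta (r + n) b\<close> replaces \<open>pochhammer r n\<close> by
  \<open>pochhammer (r + b) n\<close>. The coefficients may change sign, so the exchange rests on
  absolute summability, which \<open>p + q < r + b\<close> provides.\<close>

lemma has_bochner_integral_hyp2F1:
  assumes r: "r > 0" and b: "b > 0" and less: "p + q < r + b"
  shows "has_bochner_integral lborel
    (\<lambda>x. indicator {0<..<1} x * (x powr (r - 1) * (1 - x) powr (b - 1) * hyp2F1 p q r x))
    (Beta r b * hyp2F1 p q (r + b) 1)"
proof -
  define g where "g n x = indicator {0<..<1} x * (x powr (r + real n - 1) * (1 - x) powr (b - 1))" for n :: nat and x :: real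
  define f where "f n x = hyp_coeff p q r n * g n x" for n and x :: real
  have g: "has_bochner_integral lborel (g n) (Beta (r + n) b)" for n
    unfolding g_def using r b by (intro has_bochner_integral_Beta) auto
  have f: "has_bochner_integral lborel (f n) (hyp_coeff p q r n * Beta (r + n) b)" for n
    unfolding f_def by (intro has_bochner_integral_mult_right g)
  have norm_f: "norm (f n x) = \<bar>hyp_coeff p q r n\<bar> * g n x" for n x
    by (simp add: f_def abs_mult g_def)
  have coeff: "hyp_coeff p q r n * Beta (r + n) b = Beta r b * hyp_coeff p q (r + b) n" for n
    using r by (simp add: Beta_add_nat[OF r b] hyp_coeff_def pochhammer_pos[THEN less_imp_neq, symmetric])
  have rb: "r + b \<notin> \<int>\<^sub>\<le>\<^sub>0"
    using r b by (auto dest: nonpos_Ints_nonpos)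
  have summable_coeff: "summable (\<lambda>n. \<bar>hyp_coeff p q (r + b) n\<bar>)"
    using rb less by (rule summable_abs_hyp_coeff)
  have *: "f n x = indicator {0<..<1} x * (x powr (r - 1) * (1 - x) powr (b - 1)) * (hyp_coeff p q r n * x ^ n)" for n x
    by (auto simp: f_def g_def indicator_def powr_diff powr_add powr_realpow)
  have integrable: "integrable lborel (f n)" for n
    using f by (simp add: has_bochner_integral_iff)
  have AE: "AE x in lborel. summable (\<lambda>n. norm (f n x))"
  proof (rule AE_I2)
    fix x :: real
    show "summable (\<lambda>n. norm (f n x))"
    proof (cases "x \<in> {0<..<1}")
      case True
      then have "summable (\<lambda>n. (x powr (r - 1) * (1 - x) powr (b - 1)) * \<bar>hyp_coeff p q r n * x ^ n\<bar>)"
        by (intro summable_mult summable_hyp2F1) auto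
      then show ?thesis
        unfolding * using True by (simp add: abs_mult)
    qed (simp add: *)
  qed
  have "(\<integral>x. norm (f n x) \<partial>lborel) = \<bar>hyp_coeff p q r n\<bar> * Beta (r + n) b" for n
    unfolding norm_f using has_bochner_integral_integral_eq[OF g[of n]] by simp
  also have "\<bar>hyp_coeff p q r n\<bar> * Beta (r + n) b = Beta r b * \<bar>hyp_coeff p q (r + b) n\<bar>" for n
  proof -
    have "Beta (r + n) b > 0" "Beta r b > 0"
      using r b by (simp_all add: Beta_def Gamma_real_pos)
    then show ?thesis
      using arg_cong[OF coeff[of n], of abs] by (simp add: abs_mult)
  qed
  finally have summable: "summable (\<lambda>n. \<integral>x. norm (f n x) \<partial>lborel)"
    using summable_mult[OF summable_coeff] by simp
  have "f n x = 0" if "x \<notin> {0<..<1}" for n x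
    using that by (simp add: *)
  then have suminf_f: "(\<Sum>n. f n x) =
      indicator {0<..<1} x * (x powr (r - 1) * (1 - x) powr (b - 1) * hyp2F1 p q r x)" for x
  proof (cases "x \<in> {0<..<1}")
    case True
    then have "summable (\<lambda>n. hyp_coeff p q r n * x ^ n)"
      by (intro summable_rabs_cancel[OF summable_hyp2F1]) auto
    then show ?thesis
      unfolding * hyp2F1_eq by (subst suminf_mult) auto
  qed simp
  have "(\<Sum>n. integral\<^sup>L lborel (f n)) = (\<Sum>n. Beta r b * hyp_coeff p q (r + b) n)"
    using has_bochner_integral_integral_eq[OF f] coeff by simp
  also have "\<dots> = Beta r b * hyp2F1 p q (r + b) 1"
    using summable_rabs_cancel[OF summable_coeff] by (simp add: hyp2F1_eq suminf_mult)
  finally show ?thesis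
    using integrable_suminf[OF integrable AE summable] integral_suminf[OF integrable AE summable]
    unfolding suminf_f by (simp add: has_bochner_integral_iff)
qed

text \<open>The value of the integral in \<open>has_bochner_integral_hyp2F1\<close>.\<close>

definition hyp_beta_integral :: "real \<Rightarrow> real \<Rightarrow> real \<Rightarrow> real \<Rightarrow> real" where
  "hyp_beta_integral b p q r = Beta r b * hyp2F1 p q (r + b) 1"

text \<open>Raising \<open>b\<close> by one raises the lower parameter \<open>r + b\<close>, so
  \<open>hyp2F1_at_1_contiguous\<close> applies; its factor \<open>r + b\<close> is absorbed by the
  beta function.\<close>

lemma hyp_beta_integral_add_1:
  assumes r: "r > 0" and b: "b > 0" and less: "p + q < r + b"
  shows "(r + b - p) * (r + b - q) * hyp_beta_integral (b + 1) p q r =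
    b * (r + b - p - q) * hyp_beta_integral b p q r"
proof -
  have "(r + b) * Beta r (b + 1) = b * Beta r b"
    using Beta_add_nat[OF b r, of 1] r b by (simp add: Beta_commute add.commute)
  moreover have "(r + b - p) * (r + b - q) * hyp2F1 p q (r + b + 1) 1 = (r + b) * (r + b - p - q) * hyp2F1 p q (r + b) 1"
    using r b less by (intro hyp2F1_at_1_contiguous) auto
  ultimately show ?thesis
    unfolding hyp_beta_integral_def add.assoc[symmetric] by (metis mult.assoc mult.left_commute)
qed

text \<open>Iteration of the one-step relation; the last two hypotheses keep its left-hand factor
  nonzero at each step.\<close>

lemma hyp_beta_integral_add_nat:
  assumes r: "r > 0" and b: "b > 0" and less: "p + q < r + b"
    and pq: "r + b - p > 0" "r + b - q > 0"
  shows "hyp_beta_integral (b + n) p q r = hyp_beta_integral b p q r *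
    (pochhammer b n * pochhammer (r + b - p - q) n / (pochhammer (r + b - p) n * pochhammer (r + b - q) n))"
proof (induction n)
  case (Suc n)
  have "(r + b - p + n) * (r + b - q + n) * hyp_beta_integral (b + Suc n) p q r =
      (b + n) * (r + b - p - q + n) * hyp_beta_integral (b + n) p q r"
    using hyp_beta_integral_add_1[of r "b + n" p q] assms by (simp add: algebra_simps)
  moreover have "(r + b - p + n) * (r + b - q + n) \<noteq> 0"
    using pq by simp
  ultimately have "hyp_beta_integral (b + Suc n) p q r =
      (b + n) * (r + b - p - q + n) / ((r + b - p + n) * (r + b - q + n)) * hyp_beta_integral (b + n) p q r"
    by (metis nonzero_mult_div_cancel_left times_divide_eq_left)
  then show ?case
    unfolding Suc by (simp add: pochhammer_Suc ac_simps)
qed simp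

text \<open>Read off from the integral, since the terms of the series at 1 can have either
  sign.\<close>

lemma hyp_beta_integral_nonneg:
  assumes "r > 0" "b > 0" "p + q < r + b"
    and nonneg: "\<And>x. x \<in> {0<..<1} \<Longrightarrow> hyp2F1 p q r x \<ge> 0"
  shows "hyp_beta_integral b p q r \<ge> 0"
proof -
  have "(\<integral>x. indicator {0<..<1} x * (x powr (r - 1) * (1 - x) powr (b - 1) * hyp2F1 p q r x) \<partial>lborel) \<ge> 0"
    using nonneg by (intro Bochner_Integration.integral_nonneg) (auto simp: indicator_def)
  then show ?thesis
    using has_bochner_integral_integral_eq[OF has_bochner_integral_hyp2F1[OF assms(1-3)]]
    by (simp add: hyp_beta_integral_def)
qed

text \<open>The kernel is expanded in powers of \<open>y * (1 - x)\<close>, and the power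
  \<open>(1 - x) ^ n\<close> raises \<open>b\<close> to \<open>b + n\<close>. All terms are
  nonnegative, so sum and integral may be exchanged.\<close>

lemma nn_integral_hyp2F1_kernel:
  assumes r: "r > 0" and b: "b > 0" and less: "p + q < r + b"
    and pq: "r + b - p > 0" "r + b - q > 0"
    and nonneg: "\<And>x. x \<in> {0<..<1} \<Longrightarrow> hyp2F1 p q r x \<ge> 0"
    and y: "y \<in> {0<..<1}"
  shows "(\<integral>\<^sup>+ x. ennreal (indicator {0<..<1} x * (x powr (r - 1) * (1 - x) powr (b - 1) * hyp2F1 p q r x) *
      (1 - y * (1 - x)) powr (- (r + b - q))) \<partial>lborel) =
    ennreal (hyp_beta_integral b p q r * hyp2F1 b (r + b - p - q) (r + b - p) y)"
proof -
  define s where "s = r + b - q"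
  define g where "g c x = indicator {0<..<1} x * (x powr (r - 1) * (1 - x) powr (c - 1) * hyp2F1 p q r x)" for c x :: real
  define k where "k n = pochhammer s n / fact n * y ^ n" for n
  have [measurable]: "g c \<in> borel_measurable borel" for c
    unfolding g_def by measurable
  have g_nonneg: "g c x \<ge> 0" for c x
    using nonneg by (auto simp: g_def indicator_def)
  have k_nonneg: "k n \<ge> 0" for n
    using pq y by (auto simp: k_def s_def intro!: mult_nonneg_nonneg divide_nonneg_nonneg pochhammer_nonneg)
  have int_g: "has_bochner_integral lborel (g (b + n)) (hyp_beta_integral (b + n) p q r)" for n :: nat
    unfolding g_def hyp_beta_integral_def using r b less by (intro has_bochner_integral_hyp2F1) auto
  have J_nonneg: "hyp_beta_integral (b + n) p q r \<ge> 0" for n :: nat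
    using r b less nonneg by (intro hyp_beta_integral_nonneg) auto
  have nn_int: "(\<integral>\<^sup>+ x. ennreal (k n * g (b + n) x) \<partial>lborel) = ennreal (k n * hyp_beta_integral (b + n) p q r)" for n
  proof -
    have "(\<integral>\<^sup>+ x. ennreal (g (b + n) x) \<partial>lborel) = ennreal (hyp_beta_integral (b + n) p q r)"
      using int_g[of n] nn_integral_eq_integral[of lborel "g (b + n)"] g_nonneg
      by (simp add: has_bochner_integral_iff)
    then show ?thesis
      by (simp add: ennreal_mult' k_nonneg nn_integral_cmult)
  qed
  have expand: "(\<lambda>n. k n * g (b + n) x) sums (g b x * (1 - y * (1 - x)) powr (- s))" for x
  proof (cases "x \<in> {0<..<1}")
    case True
    then have "y * (1 - x) < 1 * 1"
      using y by (intro mult_strict_mono) auto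
    then have "\<bar>y * (1 - x)\<bar> < 1"
      using True y by simp
    from sums_mult[OF binomial_series_pochhammer[OF this, of s], of "g b x"]
    have "(\<lambda>n. g b x * (pochhammer s n / fact n * (y * (1 - x)) ^ n)) sums (g b x * (1 - y * (1 - x)) powr (- s))" .
    moreover have "g b x * (pochhammer s n / fact n * (y * (1 - x)) ^ n) = k n * g (b + n) x" for n
    proof -
      have "(1 - x) powr (b + n - 1) = (1 - x) powr (b - 1) * (1 - x) ^ n"
        using True by (simp add: powr_diff powr_add powr_realpow)
      then show ?thesis
        by (simp add: g_def k_def power_mult_distrib)
    qed
    ultimately show ?thesis by simp
  qed (simp add: g_def)
  \<comment> \<open>The exponent of the kernel is decisive: \<open>pochhammer s n\<close> cancels
    against the denominator \<open>pochhammer (r + b - q) n\<close>, so that two upper parameters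
    and one lower parameter remain.\<close>
  have coeff: "k n * hyp_beta_integral (b + n) p q r =
      hyp_beta_integral b p q r * (hyp_coeff b (r + b - p - q) (r + b - p) n * y ^ n)" for n
    unfolding hyp_beta_integral_add_nat[OF r b less pq]
    using pochhammer_pos[OF pq(2), of n] by (simp add: k_def s_def hyp_coeff_def)
  have summable: "summable (\<lambda>n. hyp_coeff b (r + b - p - q) (r + b - p) n * y ^ n)"
    using y by (intro summable_rabs_cancel[OF summable_hyp2F1]) auto
  have "(\<integral>\<^sup>+ x. ennreal (g b x * (1 - y * (1 - x)) powr (- s)) \<partial>lborel) =
      (\<integral>\<^sup>+ x. (\<Sum>n. ennreal (k n * g (b + n) x)) \<partial>lborel)"
    by (intro nn_integral_cong suminf_ennreal_eq[OF _ expand, symmetric] mult_nonneg_nonneg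
        k_nonneg g_nonneg)
  also have "\<dots> = (\<Sum>n. ennreal (k n * hyp_beta_integral (b + n) p q r))"
    by (subst nn_integral_suminf) (simp_all add: nn_int)
  also have "\<dots> = ennreal (\<Sum>n. k n * hyp_beta_integral (b + n) p q r)"
  proof (rule suminf_ennreal2)
    show "k n * hyp_beta_integral (b + n) p q r \<ge> 0" for n
      by (intro mult_nonneg_nonneg k_nonneg J_nonneg)
    show "summable (\<lambda>n. k n * hyp_beta_integral (b + n) p q r)"
      unfolding coeff by (rule summable_mult[OF summable])
  qed
  also have "(\<Sum>n. k n * hyp_beta_integral (b + n) p q r) =
      hyp_beta_integral b p q r * hyp2F1 b (r + b - p - q) (r + b - p) y"
    unfolding coeff hyp2F1_eq using summable by (rule suminf_mult)
  finally show ?thesis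
    by (simp only: g_def s_def)
qed

section \<open>Change of variables, normalization and the transformed parameters\<close>

text \<open>For fixed \<open>x\<close>, \<open>w = (1 - y) / (x * y)\<close> inverts
  \<open>y = 1 / (1 + w * x)\<close>. In \<open>u = 1 - y\<close> this map is increasing, so
  substitution applies on compact intervals \<open>{0..b n}\<close>; monotone limits and a
  reflection do the rest.\<close>

lemma nn_integral_substitution_ratio:
  fixes f :: "real \<Rightarrow> ennreal"
  assumes [measurable]: "f \<in> borel_measurable borel" and x: "x > 0"
  shows "(\<integral>\<^sup>+ w. f w * indicator {0..} w \<partial>lborel) =
    (\<integral>\<^sup>+ y. f ((1 - y) / (x * y)) * ennreal (1 / (x * y\<^sup>2)) * indicator {0<..1} y \<partial>lborel)"
proof -
  define g g' where "g u = u / (x * (1 - u))" and "g' u = 1 / (x * (1 - u)\<^sup>2)" for u :: real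
  \<comment> \<open>Chosen so that \<open>g (b n)\<close> is \<open>(n + 1) / x\<close>: both the
    intervals and their images then exhaust the two domains.\<close>
  define b where "b n = (real n + 1) / (real n + 2)" for n :: nat
  have [measurable]: "g \<in> borel_measurable borel" "g' \<in> borel_measurable borel"
    unfolding g_def[abs_def] g'_def[abs_def] by measurable
  have b: "0 < b n" "b n < 1" "1 - b n = 1 / (real n + 2)" for n
    by (auto simp: b_def field_simps)
  have g_b: "g (b n) = (real n + 1) / x" for n
  proof -
    have "real n + 2 \<noteq> 0" by linarith
    then show ?thesis
      unfolding g_def b(3) by (simp add: b_def)
  qed
  have subst: "(\<integral>\<^sup>+ w. f w * indicator {0..(real n + 1) / x} w \<partial>lborel) =
      (\<integral>\<^sup>+ u. f (g u) * g' u * indicator {0..b n} u \<partial>lborel)" for n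
  proof -
    have "(\<integral>\<^sup>+ w. f w * indicator {g 0..g (b n)} w \<partial>lborel) =
        (\<integral>\<^sup>+ u. f (g u) * g' u * indicator {0..b n} u \<partial>lborel)"
    proof (rule nn_integral_substitution_aux)
      fix u assume "u \<in> {0..b n}"
      with b(2)[of n] have "1 - u > 0" by simp
      with x have "(g has_real_derivative (x * (1 - u) - u * (x * (0 - 1))) / (x * (1 - u))\<^sup>2) (at u)"
        unfolding g_def[abs_def] by (auto intro!: derivative_eq_intros simp: power2_eq_square)
      moreover have "(x * (1 - u) - u * (x * (0 - 1))) / (x * (1 - u))\<^sup>2 = g' u"
      proof -
        have "x * (1 - u) - u * (x * (0 - 1)) = x"
          by (simp add: algebra_simps)
        then show ?thesis
          using x by (simp add: g'_def power2_eq_square)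
      qed
      ultimately show "(g has_real_derivative g' u) (at u)" by simp
    next
      show "continuous_on {0..b n} g'"
        unfolding g'_def[abs_def] using x b(2)[of n] by (intro continuous_intros) auto
    qed (use x b in \<open>auto simp: g'_def\<close>)
    then show ?thesis
      unfolding g_b by (simp add: g_def)
  qed
  have range: "(\<Union>n. {0..(real n + 1) / x}) = {0..}"
  proof (intro equalityI subsetI)
    fix w :: real assume "w \<in> {0..}"
    moreover obtain n :: nat where "w * x < n"
      using reals_Archimedean2 by blast
    ultimately show "w \<in> (\<Union>n. {0..(real n + 1) / x})"
      using x by (auto simp: field_simps intro!: exI[of _ n])
  qed auto
  have domain: "(\<Union>n. {0..b n}) = {0..<1}"
  proof (intro equalityI subsetI)
    fix u :: real assume u: "u \<in> {0..<1}"
    obtain n :: nat where "1 / (1 - u) < n"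
      using reals_Archimedean2 by blast
    with u have "u \<le> b n"
      by (simp add: b_def field_simps)
    with u show "u \<in> (\<Union>n. {0..b n})" by auto
  next
    fix u :: real assume "u \<in> (\<Union>n. {0..b n})"
    then obtain n where "0 \<le> u" "u \<le> b n" by auto
    with b(2)[of n] show "u \<in> {0..<1}" by simp
  qed
  have "(\<integral>\<^sup>+ w. f w * indicator {0..} w \<partial>lborel) = emeasure (density lborel f) (\<Union>n. {0..(real n + 1) / x})"
    unfolding range by (simp add: emeasure_density)
  also have "\<dots> = (SUP n. emeasure (density lborel f) {0..(real n + 1) / x})"
    using x by (intro SUP_emeasure_incseq[symmetric]) (auto simp: incseq_def divide_right_mono intro: order_trans)
  also have "\<dots> = (SUP n. emeasure (density lborel (\<lambda>u. f (g u) * g' u)) {0..b n})"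
    by (simp add: emeasure_density subst)
  also have "\<dots> = emeasure (density lborel (\<lambda>u. f (g u) * g' u)) (\<Union>n. {0..b n})"
  proof (intro SUP_emeasure_incseq)
    have "b m \<le> b n" if "m \<le> n" for m n
      using that by (simp add: b_def frac_le_eq divide_le_0_iff algebra_simps)
    then show "incseq (\<lambda>n. {0..b n})"
      by (auto simp: incseq_def intro: order_trans)
  qed auto
  also have "\<dots> = (\<integral>\<^sup>+ u. f (g u) * g' u * indicator {0..<1} u \<partial>lborel)"
    unfolding domain by (simp add: emeasure_density)
  also have "\<dots> = (\<integral>\<^sup>+ y. f (g (1 - y)) * g' (1 - y) * indicator {0..<1} (1 - y) \<partial>lborel)"
    by (subst nn_integral_real_affine[where t = 1 and c = "- 1"]) auto
  also have "\<dots> = (\<integral>\<^sup>+ y. f ((1 - y) / (x * y)) * ennreal (1 / (x * y\<^sup>2)) * indicator {0<..1} y \<partial>lborel)"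
    by (intro nn_integral_cong) (auto simp: g_def g'_def indicator_def)
  finally show ?thesis .
qed

lemma borel_measurable_BH_weight [measurable]: "BH_weight a b p q r \<in> borel_measurable borel"
  unfolding BH_weight_def[abs_def] by measurable

text \<open>Mass one means that \<open>C\<close> times the integral of \<open>f\<close> is 1. This
  rules out an integral 0 or infinity and determines \<open>C\<close>, so an unknown constant is
  harmless.\<close>

lemma density_normalize:
  assumes [measurable]: "f \<in> borel_measurable M"
    and "prob_space (density M (\<lambda>x. C * f x))"
  shows "density M (\<lambda>x. C * f x) = density M (\<lambda>x. f x / (\<integral>\<^sup>+ y. f y \<partial>M))"
proof -
  define Z where "Z = (\<integral>\<^sup>+ y. f y \<partial>M)"
  have "emeasure (density M (\<lambda>x. C * f x)) (space M) = 1"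
    using prob_space.emeasure_space_1[OF assms(2)] by simp
  then have CZ: "C * Z = 1"
    by (simp add: emeasure_density nn_integral_cmult Z_def cong: nn_integral_cong)
  then have "Z \<noteq> 0" "Z \<noteq> \<infinity>"
    by (auto simp: ennreal_mult_top split: if_splits)
  then have "C = C * Z / Z"
    by (metis ennreal_divide_self ennreal_times_divide infinity_ennreal_def mult.right_neutral top.not_eq_extremum)
  then have "C = 1 / Z"
    using CZ by simp
  then show ?thesis
    unfolding Z_def[symmetric] by (simp add: divide_ennreal_def mult.commute)
qed

text \<open>All powers follow from \<open>1 + w = Q / (x * y)\<close>. On the right,
  \<open>x\<close> and \<open>y\<close> interact only through
  \<open>1 - y * (1 - x)\<close>.\<close>

lemma beta2_kernel_identity:
  fixes c d x y :: real
  assumes x: "x > 0" and y: "0 < y" "y < 1" and pos: "1 - y * (1 - x) > 0"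
  defines "w \<equiv> (1 - y) / (x * y)"
  shows "w powr (c - 1) / (1 + w) powr (c + d) * (1 / (x * y\<^sup>2)) =
    (y powr (d - 1) * (1 - y) powr (c - 1)) * (x powr d * (1 - y * (1 - x)) powr (- (c + d)))"
proof -
  define Q where "Q = 1 - y * (1 - x)"
  have "1 + w = Q / (x * y)"
    using x y by (simp add: w_def Q_def field_simps)
  then show ?thesis
    using x y pos unfolding Q_def[symmetric]
    by (simp add: w_def powr_divide powr_mult powr_diff powr_add powr_minus divide_simps power2_eq_square)
qed

text \<open>The left-hand series of the second claim has positive coefficients; this is where the positivity
  required for existence of the new law comes from.\<close>

lemma BH_params_transform:
  assumes "(a, b, p, q, r) \<in> BH_params" and "a < r" "a + b - q > 0" "r + b - p > 0"
  shows "(r - a, a, q, r - p, r + b - p) \<in> BH_params"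
    and "\<And>y. y \<in> {0<..<1} \<Longrightarrow> hyp2F1 b (r + b - p - q) (r + b - p) y =
      (1 - y) powr (q - b) * hyp2F1 q (r - p) (r + b - p) y"
proof -
  from assms have *: "a > 0" "b > 0" "r + b - p - q > 0"
    by (auto simp: BH_params_def)
  have r': "r + b - p \<notin> \<int>\<^sub>\<le>\<^sub>0"
    using assms(4) nonpos_Ints_nonpos[of "r + b - p"] by auto
  show Euler: "hyp2F1 b (r + b - p - q) (r + b - p) y =
      (1 - y) powr (q - b) * hyp2F1 q (r - p) (r + b - p) y" if "y \<in> {0<..<1}" for y
    \<comment> \<open>Subtracting the upper parameters from \<open>r + b - p\<close> leaves
      \<open>r - p\<close> and \<open>q\<close>, with exponent \<open>q - b\<close>.\<close>
    using hyp2F1_Euler[OF r', of y b "r + b - p - q"] that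
    by (simp add: algebra_simps hyp2F1_commute[of q])
  have "hyp2F1 q (r - p) (r + b - p) y > 0" if y: "y \<in> {0<..<1}" for y
  proof -
    have "hyp2F1 b (r + b - p - q) (r + b - p) y > 0"
      unfolding hyp2F1_eq
    proof (rule suminf_pos)
      show "summable (\<lambda>n. hyp_coeff b (r + b - p - q) (r + b - p) n * y ^ n)"
        using y by (intro summable_rabs_cancel[OF summable_hyp2F1]) auto
      show "0 < hyp_coeff b (r + b - p - q) (r + b - p) n * y ^ n" for n
        using * assms(4) y unfolding hyp_coeff_def
        by (intro mult_pos_pos divide_pos_pos pochhammer_pos) auto
    qed
    then show ?thesis
      using Euler[OF y] y by (simp add: zero_less_mult_iff)
  qed
  \<comment> \<open>The last inequality in \<open>BH_params\<close> for the new tuple reads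
    \<open>a + b - q > 0\<close>.\<close>
  then show "(r - a, a, q, r - p, r + b - p) \<in> BH_params"
    using assms * r' by (auto simp: BH_params_def)
qed

section \<open>The law of \<open>1 / (1 + W * X)\<close>\<close>

text \<open>The left side is the expectation of \<open>h\<close> at \<open>1 / (1 + W * X)\<close>
  for independent \<open>X\<close> and \<open>W\<close>. One \<open>C\<close> serves all
  \<open>h\<close>, which makes \<open>C\<close> times the weight a density of that
  variable.\<close>

lemma nn_integral_BH_beta2:
  assumes params: "(a, b, p, q, r) \<in> BH_params" and "a < r" "a + b - q > 0" "r + b - p > 0"
  shows "\<exists>C. \<forall>h \<in> borel_measurable borel.
    (\<integral>\<^sup>+ x. (\<integral>\<^sup>+ w. h (1 / (1 + w * x)) \<partial>beta2 (a + b - q) (r - a)) \<partial>BH a b p q r) =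
    (\<integral>\<^sup>+ y. h y * (C * BH_weight (r - a) a q (r - p) (r + b - p) y) \<partial>lborel)"
proof -
  define c d where "c = a + b - q" and "d = r - a"
  have cd: "c > 0" "d > 0" "c + d = r + b - q"
    using assms by (auto simp: c_def d_def)
  from params have P: "a > 0" "b > 0" "r + b - p - q > 0" "\<And>x. x \<in> {0<..<1} \<Longrightarrow> hyp2F1 p q r x > 0"
    by (auto simp: BH_params_def)
  define Z where "Z = (\<integral>\<^sup>+ y. BH_weight a b p q r y \<partial>lborel)"
  define D :: "real \<Rightarrow> ennreal" where "D w = ennreal (indicator {0<..} w *
       (1 / Beta c d * (w powr (c - 1) / (1 + w) powr (c + d))))" for w
  \<comment> \<open>For fixed \<open>x\<close> in the unit interval, \<open>K x\<close> is the
    density of \<open>1 / (1 + W * x)\<close>: the density \<open>D\<close> of \<open>W\<close>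
    times the Jacobian.\<close>
  define K :: "real \<Rightarrow> real \<Rightarrow> ennreal" where
    "K x y = D ((1 - y) / (x * y)) * ennreal (1 / (x * y\<^sup>2)) * indicator {0<..1} y" for x y
  have [measurable]: "D \<in> borel_measurable borel"
    unfolding D_def[abs_def] by measurable
  have [measurable]: "(\<lambda>(x, y). K x y) \<in> borel_measurable (borel \<Otimes>\<^sub>M borel)"
    unfolding K_def by measurable
  define J where "J = hyp_beta_integral b p q r"
  have div: "u / Z * v = u * v / Z" for u v :: ennreal
    by (simp add: divide_ennreal_def mult_ac)
  have Beta_pos: "Beta c d > 0"
    using cd by (simp add: Beta_def Gamma_real_pos)
  \<comment> \<open>Averaging \<open>K x y\<close> over the law of \<open>X\<close>; the prefactor
    on the right is the witness for \<open>C\<close>.\<close>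
  have marginal: "(\<integral>\<^sup>+ x. BH_weight a b p q r x / Z * K x y \<partial>lborel) =
      ennreal (J / Beta c d) / Z * BH_weight (r - a) a q (r - p) (r + b - p) y" for y
  proof (cases "y \<in> {0<..<1}")
    case False
    then have "K x y = 0" for x
      \<comment> \<open>The point \<open>y = 1\<close> corresponds to \<open>w = 0\<close>, where
        \<open>D\<close> is 0.\<close>
      by (cases "y = 1") (auto simp: K_def D_def)
    then show ?thesis
      using False by (simp add: BH_weight_def)
  next
    case True
    define m where "m = y powr (d - 1) * (1 - y) powr (c - 1)"
    define k where "k x = indicator {0<..<1} x * (x powr (r - 1) * (1 - x) powr (b - 1) * hyp2F1 p q r x) *
      (1 - y * (1 - x)) powr (- (r + b - q))" for x
    have k_nonneg: "k x \<ge> 0" for x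
      using P(4)[of x] by (auto simp: k_def indicator_def)
    have [measurable]: "k \<in> borel_measurable borel"
      unfolding k_def[abs_def] by measurable
    have "BH_weight a b p q r x / Z * K x y = ennreal (m / Beta c d) / Z * ennreal (k x)" for x
    proof (cases "x \<in> {0<..<1}")
      case x: True
      have "y * (1 - x) < 1 * 1"
        using x True by (intro mult_strict_mono) auto
      then have pos: "1 - y * (1 - x) > 0" by simp
      have w: "(1 - y) / (x * y) > 0"
        using x True by simp
      have "K x y = ennreal (1 / Beta c d * (((1 - y) / (x * y)) powr (c - 1) / (1 + (1 - y) / (x * y)) powr (c + d)) * (1 / (x * y\<^sup>2)))"
        unfolding K_def D_def using True x w Beta_pos by (subst ennreal_mult) auto
      also have "\<dots> = ennreal (1 / Beta c d * (m * (x powr d * (1 - y * (1 - x)) powr (- (c + d)))))"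
        using beta2_kernel_identity[of x y c d] x True pos unfolding m_def by (simp only: mult.assoc) auto
      finally have K: "K x y = ennreal (1 / Beta c d * (m * (x powr d * (1 - y * (1 - x)) powr (- (c + d)))))" .
      \<comment> \<open>From \<open>a + d = r\<close>: the exponent of \<open>x\<close> now fits the
        lower parameter, as the kernel lemma demands.\<close>
      have "x powr (r - 1) = x powr (a - 1) * x powr d"
        by (simp add: d_def flip: powr_add)
      then have "(x powr (a - 1) * (1 - x) powr (b - 1) * hyp2F1 p q r x) *
          (1 / Beta c d * (m * (x powr d * (1 - y * (1 - x)) powr (- (c + d))))) = m / Beta c d * k x"
        using x by (simp add: k_def cd(3))
      moreover have "hyp2F1 p q r x > 0" "m \<ge> 0"
        using P(4)[OF x] by (simp_all add: m_def)
      ultimately have "BH_weight a b p q r x * K x y = ennreal (m / Beta c d) * ennreal (k x)"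
        unfolding BH_weight_def K using x Beta_pos k_nonneg by (simp flip: ennreal_mult)
      then show ?thesis
        unfolding div by simp
    qed (simp add: BH_weight_def k_def)
    then have "(\<integral>\<^sup>+ x. BH_weight a b p q r x / Z * K x y \<partial>lborel) =
        ennreal (m / Beta c d) / Z * (\<integral>\<^sup>+ x. ennreal (k x) \<partial>lborel)"
      by (simp add: nn_integral_cmult)
    also have "(\<integral>\<^sup>+ x. ennreal (k x) \<partial>lborel) = ennreal (J * hyp2F1 b (r + b - p - q) (r + b - p) y)"
      unfolding k_def J_def using P assms cd True
      by (intro nn_integral_hyp2F1_kernel) (auto intro: less_imp_le)
    also have "hyp2F1 b (r + b - p - q) (r + b - p) y = (1 - y) powr (q - b) * hyp2F1 q (r - p) (r + b - p) y"
      using BH_params_transform(2)[OF params assms(2-4) True] .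
    finally have *: "(\<integral>\<^sup>+ x. BH_weight a b p q r x / Z * K x y \<partial>lborel) =
      ennreal (m / Beta c d) / Z * ennreal (J * ((1 - y) powr (q - b) * hyp2F1 q (r - p) (r + b - p) y))" .
    have J: "J \<ge> 0"
      unfolding J_def using P assms by (intro hyp_beta_integral_nonneg) (auto intro: less_imp_le)
    have F: "hyp2F1 q (r - p) (r + b - p) y > 0"
      using BH_params_transform(1)[OF params assms(2-4)] True by (auto simp: BH_params_def)
    \<comment> \<open>As \<open>c = a + b - q\<close>, Euler's factor changes the exponent
      \<open>c - 1\<close> into \<open>a - 1\<close>.\<close>
    have "(1 - y) powr (a - 1) = (1 - y) powr (c - 1) * (1 - y) powr (q - b)"
      by (simp add: c_def flip: powr_add)
    then have "m / Beta c d * (J * ((1 - y) powr (q - b) * hyp2F1 q (r - p) (r + b - p) y)) =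
      J / Beta c d * (y powr (d - 1) * (1 - y) powr (a - 1) * hyp2F1 q (r - p) (r + b - p) y)"
      by (simp add: m_def)
    then have "ennreal (m / Beta c d) * ennreal (J * ((1 - y) powr (q - b) * hyp2F1 q (r - p) (r + b - p) y)) =
      ennreal (J / Beta c d) * BH_weight (r - a) a q (r - p) (r + b - p) y"
      using True J F Beta_pos by (simp add: BH_weight_def d_def m_def flip: ennreal_mult)
    then show ?thesis
      unfolding * by (simp only: div)
  qed
  have "(\<integral>\<^sup>+ x. (\<integral>\<^sup>+ w. h (1 / (1 + w * x)) \<partial>beta2 c d) \<partial>BH a b p q r) =
      (\<integral>\<^sup>+ y. h y * (ennreal (J / Beta c d) / Z * BH_weight (r - a) a q (r - p) (r + b - p) y) \<partial>lborel)"
    if [measurable]: "h \<in> borel_measurable borel" for h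
  proof -
    have beta2: "(\<integral>\<^sup>+ w. h (1 / (1 + w * x)) \<partial>beta2 c d) = (\<integral>\<^sup>+ w. D w * h (1 / (1 + w * x)) \<partial>lborel)" for x
      unfolding beta2_def D_def by (subst nn_integral_density) auto
    have inner: "(\<integral>\<^sup>+ w. h (1 / (1 + w * x)) \<partial>beta2 c d) = (\<integral>\<^sup>+ y. K x y * h y \<partial>lborel)" if "x \<in> {0<..<1}" for x
    proof -
      have "(\<integral>\<^sup>+ w. h (1 / (1 + w * x)) \<partial>beta2 c d) = (\<integral>\<^sup>+ w. (D w * h (1 / (1 + w * x))) * indicator {0..} w \<partial>lborel)"
        unfolding beta2 by (intro nn_integral_cong) (auto simp: D_def indicator_def)
      also have "\<dots> = (\<integral>\<^sup>+ y. (D ((1 - y) / (x * y)) * h (1 / (1 + (1 - y) / (x * y) * x))) *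
          ennreal (1 / (x * y\<^sup>2)) * indicator {0<..1} y \<partial>lborel)"
        using that by (intro nn_integral_substitution_ratio) auto
      also have "\<dots> = (\<integral>\<^sup>+ y. K x y * h y \<partial>lborel)"
      proof (intro nn_integral_cong)
        fix y :: real
        have "1 / (1 + (1 - y) / (x * y) * x) = y" if "y > 0"
          using that \<open>x \<in> {0<..<1}\<close> by (simp add: field_simps)
        then show "(D ((1 - y) / (x * y)) * h (1 / (1 + (1 - y) / (x * y) * x))) *
            ennreal (1 / (x * y\<^sup>2)) * indicator {0<..1} y = K x y * h y"
          by (auto simp: K_def indicator_def mult_ac)
      qed
      finally show ?thesis .
    qed
    have [measurable]: "(\<lambda>x. \<integral>\<^sup>+ w. h (1 / (1 + w * x)) \<partial>beta2 c d) \<in> borel_measurable borel"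
      unfolding beta2 by measurable
    have "(\<integral>\<^sup>+ x. (\<integral>\<^sup>+ w. h (1 / (1 + w * x)) \<partial>beta2 c d) \<partial>BH a b p q r) =
        (\<integral>\<^sup>+ x. BH_weight a b p q r x / Z * (\<integral>\<^sup>+ w. h (1 / (1 + w * x)) \<partial>beta2 c d) \<partial>lborel)"
      unfolding BH_def Z_def by (subst nn_integral_density) auto
    also have "\<dots> = (\<integral>\<^sup>+ x. (\<integral>\<^sup>+ y. BH_weight a b p q r x / Z * K x y * h y \<partial>lborel) \<partial>lborel)"
    proof (intro nn_integral_cong)
      fix x :: real
      show "BH_weight a b p q r x / Z * (\<integral>\<^sup>+ w. h (1 / (1 + w * x)) \<partial>beta2 c d) =
          (\<integral>\<^sup>+ y. BH_weight a b p q r x / Z * K x y * h y \<partial>lborel)"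
        by (cases "x \<in> {0<..<1}")
          (simp_all add: inner BH_weight_def mult.assoc flip: nn_integral_cmult)
    qed
    also have "\<dots> = (\<integral>\<^sup>+ y. (\<integral>\<^sup>+ x. BH_weight a b p q r x / Z * K x y * h y \<partial>lborel) \<partial>lborel)"
      by (rule lborel_pair.Fubini') simp
    also have "\<dots> = (\<integral>\<^sup>+ y. h y * (ennreal (J / Beta c d) / Z * BH_weight (r - a) a q (r - p) (r + b - p) y) \<partial>lborel)"
    proof (intro nn_integral_cong)
      fix y :: real
      have "(\<integral>\<^sup>+ x. BH_weight a b p q r x / Z * K x y * h y \<partial>lborel) =
          (\<integral>\<^sup>+ x. BH_weight a b p q r x / Z * K x y \<partial>lborel) * h y"
        unfolding K_def by (rule nn_integral_multc) measurable
      then show "(\<integral>\<^sup>+ x. BH_weight a b p q r x / Z * K x y * h y \<partial>lborel) =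
          h y * (ennreal (J / Beta c d) / Z * BH_weight (r - a) a q (r - p) (r + b - p) y)"
        unfolding marginal by (rule trans) (rule mult.commute)
    qed
    finally show ?thesis .
  qed
  then show ?thesis
    unfolding c_def d_def by blast
qed

text \<open>Independence makes the joint law a product. Taking indicators for \<open>h\<close> shows
  that the law has density \<open>C * f\<close>, and \<open>density_normalize\<close> identifies
  it.\<close>

lemma distr_BH_beta2:
  assumes M: "prob_space M"
    and params: "(a, b, p, q, r) \<in> BH_params" "a < r" "a + b - q > 0" "r + b - p > 0"
    and X: "distr M borel X = BH a b p q r" and W: "distr M borel W = beta2 (a + b - q) (r - a)"
    and indep: "prob_space.indep_var M borel X borel W"
  shows "distr M borel (\<lambda>\<omega>. 1 / (1 + W \<omega> * X \<omega>)) = BH (r - a) a q (r - p) (r + b - p)"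
proof -
  interpret prob_space M by fact
  from indep have [measurable]: "X \<in> borel_measurable M" "W \<in> borel_measurable M"
    and joint: "distr M (borel \<Otimes>\<^sub>M borel) (\<lambda>\<omega>. (X \<omega>, W \<omega>)) = BH a b p q r \<Otimes>\<^sub>M beta2 (a + b - q) (r - a)"
    unfolding indep_var_distribution_eq X W by auto
  interpret W: prob_space "beta2 (a + b - q) (r - a)"
    unfolding W[symmetric] by (rule prob_space_distr) simp
  define f where "f = BH_weight (r - a) a q (r - p) (r + b - p)"
  have [measurable]: "f \<in> borel_measurable borel"
    unfolding f_def by simp
  define Y where "Y \<omega> = 1 / (1 + W \<omega> * X \<omega>)" for \<omega>
  have [measurable]: "Y \<in> borel_measurable M"
    unfolding Y_def[abs_def] by measurable
  obtain C where C: "\<And>h. h \<in> borel_measurable borel \<Longrightarrow>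
    (\<integral>\<^sup>+ x. (\<integral>\<^sup>+ w. h (1 / (1 + w * x)) \<partial>beta2 (a + b - q) (r - a)) \<partial>BH a b p q r) =
    (\<integral>\<^sup>+ y. h y * (C * f y) \<partial>lborel)"
    using nn_integral_BH_beta2[OF params] unfolding f_def by blast
  have "distr M borel Y = density lborel (\<lambda>y. C * f y)"
  proof (rule measure_eqI)
    fix A assume "A \<in> sets (distr M borel Y)"
    then have [measurable]: "A \<in> sets borel" by simp
    have sets: "sets (BH a b p q r) = sets borel" "sets (beta2 (a + b - q) (r - a)) = sets borel"
      unfolding BH_def beta2_def by simp_all
    have "emeasure (distr M borel Y) A = (\<integral>\<^sup>+ \<omega>. indicator A (Y \<omega>) \<partial>M)"
      by (simp add: nn_integral_distr flip: nn_integral_indicator)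
    also have "\<dots> = (\<integral>\<^sup>+ z. indicator A (1 / (1 + snd z * fst z)) \<partial>distr M (borel \<Otimes>\<^sub>M borel) (\<lambda>\<omega>. (X \<omega>, W \<omega>)))"
      by (subst nn_integral_distr) (auto simp: Y_def)
    also have "\<dots> = (\<integral>\<^sup>+ x. (\<integral>\<^sup>+ w. indicator A (1 / (1 + w * x)) \<partial>beta2 (a + b - q) (r - a)) \<partial>BH a b p q r)"
      unfolding joint by (subst W.nn_integral_fst[symmetric]) (auto cong: measurable_cong_sets sets_pair_measure_cong simp: sets)
    also have "\<dots> = (\<integral>\<^sup>+ y. indicator A y * (C * f y) \<partial>lborel)"
      by (rule C) simp
    also have "\<dots> = emeasure (density lborel (\<lambda>y. C * f y)) A"
      by (simp add: emeasure_density mult.commute)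
    finally show "emeasure (distr M borel Y) A = emeasure (density lborel (\<lambda>y. C * f y)) A" .
  qed simp
  moreover have "prob_space (distr M borel Y)"
    by (rule prob_space_distr) simp
  ultimately show ?thesis
    using density_normalize[of f lborel C] unfolding Y_def[abs_def, symmetric]
    by (simp add: f_def BH_def)
qed

section \<open>From the independent pair to both laws\<close>

text \<open>Each coordinate is a measurable function of the pair, so its preimages are among those
  of the pair.\<close>

lemma indep_var_of_indep_set_pair:
  fixes M :: "'a measure" and X W W' :: "'a \<Rightarrow> real"
  assumes "prob_space M"
    and [measurable]: "X \<in> borel_measurable M" "W \<in> borel_measurable M" "W' \<in> borel_measurable M"
    and indep: "prob_space.indep_set M
      {(\<lambda>\<omega>. (W \<omega>, W' \<omega>)) -` A \<inter> space M | A. A \<in> sets (borel \<Otimes>\<^sub>M borel)}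
      {X -` B \<inter> space M | B. B \<in> sets borel}"
  shows "prob_space.indep_var M borel X borel W" "prob_space.indep_var M borel X borel W'"
proof -
  interpret prob_space M by fact
  \<comment> \<open>Needed because \<open>indep_var_eq\<close> speaks of the generated
    sigma-algebras.\<close>
  have Int_stable: "Int_stable {Y -` B \<inter> space M | B. B \<in> sets borel}" for Y :: "'a \<Rightarrow> real"
  proof (safe intro!: Int_stableI)
    fix A B :: "real set" assume "A \<in> sets borel" "B \<in> sets borel"
    then show "\<exists>C. (Y -` A \<inter> space M) \<inter> (Y -` B \<inter> space M) = Y -` C \<inter> space M \<and> C \<in> sets borel"
      by (intro exI[of _ "A \<inter> B"]) auto
  qed
  have *: "indep_var borel X borel (\<lambda>\<omega>. f (W \<omega>, W' \<omega>))"
    if [measurable]: "f \<in> borel_measurable (borel \<Otimes>\<^sub>M borel)" for f :: "real \<times> real \<Rightarrow> real"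
    unfolding indep_var_eq
  proof (intro conjI indep_set_sigma_sets Int_stable)
    show "indep_set {X -` A \<inter> space M | A. A \<in> sets borel} {(\<lambda>\<omega>. f (W \<omega>, W' \<omega>)) -` B \<inter> space M | B. B \<in> sets borel}"
    proof (safe intro!: indep_setI)
      fix A B :: "real set" assume [measurable]: "A \<in> sets borel" "B \<in> sets borel"
      have "f -` B \<in> sets (borel \<Otimes>\<^sub>M borel)"
        using measurable_sets[of f "borel \<Otimes>\<^sub>M borel" borel B] by (simp add: space_pair_measure)
      then have "(\<lambda>\<omega>. f (W \<omega>, W' \<omega>)) -` B \<inter> space M \<in>
          {(\<lambda>\<omega>. (W \<omega>, W' \<omega>)) -` A \<inter> space M | A. A \<in> sets (borel \<Otimes>\<^sub>M borel)}"
        by (intro CollectI exI[of _ "f -` B"]) auto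
      moreover have "X -` A \<inter> space M \<in> {X -` B \<inter> space M | B. B \<in> sets borel}"
        using \<open>A \<in> sets borel\<close> by (intro CollectI exI[of _ A]) simp
      ultimately have "prob (((\<lambda>\<omega>. f (W \<omega>, W' \<omega>)) -` B \<inter> space M) \<inter> (X -` A \<inter> space M)) =
          prob ((\<lambda>\<omega>. f (W \<omega>, W' \<omega>)) -` B \<inter> space M) * prob (X -` A \<inter> space M)"
        by (rule indep_setD[OF indep])
      then show "prob ((X -` A \<inter> space M) \<inter> ((\<lambda>\<omega>. f (W \<omega>, W' \<omega>)) -` B \<inter> space M)) =
          prob (X -` A \<inter> space M) * prob ((\<lambda>\<omega>. f (W \<omega>, W' \<omega>)) -` B \<inter> space M)"
        by (simp only: Int_commute mult.commute)
    qed simp_all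
  qed simp_all
  show "indep_var borel X borel W" "indep_var borel X borel W'"
    using *[of fst] *[of snd] by simp_all
qed

theorem theorem3p3:
  fixes M :: "'a measure" and X W W' :: "'a \<Rightarrow> real"
    and t1 t2 t3 t4 t5 :: real
  assumes "prob_space M"
    and "BH_theta_exists t1 t2 t3 t4 t5"
    and "t1 + t5 > 0" and "t1 + t4 > 0" and "t2 + t3 > 0"
    and "X \<in> borel_measurable M" and "W \<in> borel_measurable M" and "W' \<in> borel_measurable M"
    and "distr M borel X = BH_theta t1 t2 t3 t4 t5"
    and "distr M borel W = beta2 (t1 + t5) (t2 + t3)"
    and "distr M borel W' = beta2 (t1 + t4) (t2 + t3)"
    and "prob_space.indep_set M
           {(\<lambda>\<omega>. (W \<omega>, W' \<omega>)) -` A \<inter> space M | A. A \<in> sets (borel \<Otimes>\<^sub>M borel)}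
           {X -` B \<inter> space M | B. B \<in> sets borel}"
  shows "BH_theta_exists t5 t1 t4 t2 t3 \<and>
         distr M borel (\<lambda>\<omega>. 1 / (1 + W \<omega> * X \<omega>)) = BH_theta t5 t1 t4 t2 t3 \<and>
         BH_theta_exists t4 t1 t5 t2 t3 \<and>
         distr M borel (\<lambda>\<omega>. 1 / (1 + W' \<omega> * X \<omega>)) = BH_theta t4 t1 t5 t2 t3"
proof -
  \<comment> \<open>Stated for general \<open>u4\<close>, \<open>u5\<close>, \<open>V\<close>, so
    that both claims are instances.\<close>
  have main: "BH_theta_exists u5 t1 u4 t2 t3 \<and>
      distr M borel (\<lambda>\<omega>. 1 / (1 + V \<omega> * X \<omega>)) = BH_theta u5 t1 u4 t2 t3"
    if ex: "BH_theta_exists t1 t2 t3 u4 u5" and pos: "t1 + u5 > 0" "t1 + u4 > 0"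
      and X: "distr M borel X = BH_theta t1 t2 t3 u4 u5" and V: "distr M borel V = beta2 (t1 + u5) (t2 + t3)"
      and indep: "prob_space.indep_var M borel X borel V" for u4 u5 V
  proof -
    define a b p q r where d: "a = u4 + u5" "b = t1 + t3" "p = t3 + u5" "q = t3 + u4" "r = t2 + t3 + u4 + u5"
    \<comment> \<open>These values match the parameters of \<open>beta2\<close> and the transformed
      tuple with those of the theorem.\<close>
    have e: "a + b - q = t1 + u5" "r - a = t2 + t3" "r - p = t2 + u4" "r + b - p = t1 + u4 + t2 + t3"
      by (simp_all add: d)
    have params: "(a, b, p, q, r) \<in> BH_params" "a < r" "a + b - q > 0" "r + b - p > 0"
      using ex pos \<open>t2 + t3 > 0\<close> unfolding e by (simp_all add: BH_theta_exists_def d)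
    have "BH_theta u5 t1 u4 t2 t3 = BH (r - a) a q (r - p) (r + b - p)"
      unfolding BH_theta_def e by (simp add: d add_ac)
    moreover have "BH_theta_exists u5 t1 u4 t2 t3"
      using BH_params_transform(1)[OF params] unfolding BH_theta_exists_def e by (simp add: d add_ac)
    moreover have "distr M borel (\<lambda>\<omega>. 1 / (1 + V \<omega> * X \<omega>)) = BH (r - a) a q (r - p) (r + b - p)"
      using assms(1) params
    proof (rule distr_BH_beta2)
      show "distr M borel X = BH a b p q r"
        unfolding X BH_theta_def d ..
      show "distr M borel V = beta2 (a + b - q) (r - a)"
        unfolding V e ..
    qed (rule indep)
    ultimately show ?thesis by simp
  qed
  note indep = indep_var_of_indep_set_pair[OF assms(1,6,7,8,12)]
  \<comment> \<open>Exchanging \<open>t4\<close> and \<open>t5\<close> merely exchanges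
    \<open>p\<close> and \<open>q\<close>.\<close>
  have swap: "BH_theta_exists t1 t2 t3 t5 t4 = BH_theta_exists t1 t2 t3 t4 t5"
    "BH_theta t1 t2 t3 t5 t4 = BH_theta t1 t2 t3 t4 t5"
    by (simp_all add: BH_theta_exists_def BH_theta_def BH_params_def BH_def BH_weight_def[abs_def]
        hyp2F1_commute[of "t3 + t5"] add_ac diff_diff_eq)
  show ?thesis
    using main[OF assms(2,3,4,9,10) indep(1)]
      main[of t5 t4 W', unfolded swap, OF assms(2,4,3,9,11) indep(2)] by blast
qed

end
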